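(* For all $w_1,w_2\in\mathbb{N}$ and all integers $n\geq 0$, the following identity holds (as polynomials in $x$): $$\sum_{i=0}^n\binom{n}{i}B_i(w_2x)\,S_{n-i}(w_1-1)\,w_1^{i-1}w_2^{n-i}=\sum_{i=0}^n\binom{n}{i}B_i(w_1x)\,S_{n-i}(w_2-1)\,w_2^{i-1}w_1^{n-i},$$ where $\binom{n}{i}$ is the binomial coefficient.
   Context: $\mathbb{N}$ denotes the positive integers. $B_n(x)$ are the ordinary Bernoulli polynomials, $\frac{te^{xt}}{e^t-1}=\sum_{n\ge0}B_n(x)\frac{t^n}{n!}$. For integers $k\ge0$ and $n\ge0$, $S_k(n)=0^k+1^k+\cdots+n^k$, with the convention $0^0=1$. *)

theory Defs
  imports "HOL-Computational_Algebra.Computational_Algebra"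
begin

text \<open>
  The generating function $t e^{xt} / (e^t - 1)$ as a power series in $t$ over the polynomials
  in $x$. The ring of polynomials is not a field, so the quotient $t / (e^t - 1)$ is formed over
  the coefficient field, where it is exact, and its coefficients are then read as constant
  polynomials.
\<close>

definition bernoulli_gf :: "'a :: field_char_0 poly fps" where
  "bernoulli_gf =
     Abs_fps (\<lambda>n. [:fps_nth (fps_X / (fps_exp 1 - 1)) n:]) * Abs_fps (\<lambda>n. monom (1 / fact n) n)"

definition bernoulli_poly :: "nat \<Rightarrow> 'a :: field_char_0 poly" where
  "bernoulli_poly n = smult (fact n) (fps_nth bernoulli_gf n)"

definition power_sum :: "nat \<Rightarrow> nat \<Rightarrow> nat" where
  "power_sum k n = (\<Sum>j=0..n. j ^ k)"

lemma fps_exp_minus_1_dvd_X: "fps_exp 1 - 1 dvd (fps_X :: 'a :: field_char_0 fps)"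
proof -
  have nz: "fps_nth (fps_exp 1 - 1 :: 'a fps) 1 \<noteq> 0" by simp
  hence "fps_exp 1 - 1 \<noteq> (0 :: 'a fps)" by (metis fps_zero_nth)
  moreover have "subdegree (fps_exp 1 - 1 :: 'a fps) \<le> 1" using nz by (rule subdegree_leI)
  ultimately show ?thesis by (subst fps_dvd_iff) simp_all
qed

lemma bernoulli_gf_eq:
  "(Abs_fps (\<lambda>n. [:1 / fact n:]) - 1) * bernoulli_gf =
     fps_X * Abs_fps (\<lambda>n. monom (1 / fact n) n :: 'a :: field_char_0 poly)"
proof -
  let ?c = "\<lambda>f :: 'a fps. Abs_fps (\<lambda>n. [:fps_nth f n:])"
  have mult: "?c f * ?c g = ?c (f * g)" for f g
  proof (rule fps_ext)
    fix n
    have hom: "(\<Sum>i\<in>A. [:h i:]) = [:sum h A:]" for h :: "nat \<Rightarrow> 'a" and A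
      by (induction A rule: infinite_finite_induct) auto
    show "fps_nth (?c f * ?c g) n = fps_nth (?c (f * g)) n"
      by (simp add: fps_mult_nth hom mult.commute)
  qed
  have "Abs_fps (\<lambda>n. [:1 / fact n:]) - 1 = ?c (fps_exp 1 - 1)"
    by (rule fps_ext) (auto simp: one_pCons)
  moreover have "?c fps_X = fps_X"
    by (rule fps_ext) (auto simp: fps_X_def one_pCons)
  moreover have "(fps_exp 1 - 1) * (fps_X / (fps_exp 1 - 1)) = (fps_X :: 'a fps)"
    by (rule dvd_mult_div_cancel) (rule fps_exp_minus_1_dvd_X)
  ultimately show ?thesis
    by (simp only: bernoulli_gf_def mult mult.assoc [symmetric])
qed

lemma bernoulli_poly_gf_at:
  "Abs_fps (\<lambda>n. poly (bernoulli_poly n) x / fact n) =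
     fps_X * fps_exp x / (fps_exp 1 - 1 :: 'a :: field_char_0 fps)"
proof -
  have "Abs_fps (\<lambda>n. poly (bernoulli_poly n) x / fact n) = fps_X / (fps_exp 1 - 1) * fps_exp x"
    by (rule fps_ext)
       (simp add: bernoulli_poly_def bernoulli_gf_def fps_mult_nth poly_sum poly_monom)
  thus ?thesis
    by (simp add: dvd_div_mult fps_exp_minus_1_dvd_X)
qed

end

theory Submission
  imports Defs
begin

text \<open>
  Up to the factor \<open>n!\<close>, the left-hand side at \<open>x\<close> is the \<open>n\<close>-th coefficient in \<open>t\<close> of
  \<open>(1/w1) * (w1 t exp(w1 w2 x t) / (exp(w1 t) - 1)) * (\<Sum>j<w1. exp(j w2 t))\<close>.
  The last factor is geometric, so this series equals
  \<open>t exp(w1 w2 x t) (exp(w1 w2 t) - 1) / ((exp(w1 t) - 1) (exp(w2 t) - 1))\<close>,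
  which is symmetric in \<open>w1\<close> and \<open>w2\<close>.
\<close>

definition symmetric_series :: "nat \<Rightarrow> nat \<Rightarrow> 'a :: field_char_0 \<Rightarrow> 'a fps" where
  "symmetric_series v w x =
     fps_const (1 / of_nat v) *
     Abs_fps (\<lambda>n. of_nat v ^ n * (poly (bernoulli_poly n) (of_nat w * x) / fact n)) *
     (\<Sum>j<v. fps_exp (of_nat (j * w)))"

lemma fps_exp_minus_1_nonzero:
  assumes "c \<noteq> 0"
  shows "fps_exp c - 1 \<noteq> (0 :: 'a :: field_char_0 fps)"
proof
  assume "fps_exp c - 1 = (0 :: 'a fps)"
  hence "fps_nth (fps_exp c - 1) 1 = (0 :: 'a)" by simp
  with assms show False by simp
qed

text \<open>This is the generating function at \<open>y\<close> with \<open>c * t\<close>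
  substituted for \<open>t\<close>. The product form avoids dividing by
  \<open>fps_exp c - 1\<close>, which is never a unit.\<close>

lemma bernoulli_series_mult_exp:
  "Abs_fps (\<lambda>n. c ^ n * (poly (bernoulli_poly n) y / fact n)) * (fps_exp c - 1) =
     fps_const c * fps_X * fps_exp (c * y :: 'a :: field_char_0)"
proof -
  define G where "G = Abs_fps (\<lambda>n. poly (bernoulli_poly n) y / fact n)"
  \<comment> \<open>Since \<open>fps_exp 1 - 1\<close> has constant term 0, multiplying the quotient
    back is justified by divisibility, not by invertibility.\<close>
  have "fps_exp 1 - 1 dvd fps_X * fps_exp y"
    by (intro dvd_mult2 fps_exp_minus_1_dvd_X)
  hence "G * (fps_exp 1 - 1) = fps_X * fps_exp y"
    unfolding G_def bernoulli_poly_gf_at by (rule dvd_div_mult_self)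
  hence "(G * (fps_exp 1 - 1)) oo (fps_const c * fps_X) =
         (fps_X * fps_exp y) oo (fps_const c * fps_X)"
    by simp
  moreover have "fps_exp b oo (fps_const c * fps_X) = fps_exp (c * b)" for b
    by (rule fps_ext) (simp add: fps_compose_linear power_mult_distrib)
  moreover have "G oo (fps_const c * fps_X) =
      Abs_fps (\<lambda>n. c ^ n * (poly (bernoulli_poly n) y / fact n))"
    by (simp add: fps_compose_linear G_def)
  ultimately show ?thesis
    by (simp add: fps_compose_mult_distrib fps_compose_sub_distrib fps_X_fps_compose_startby0)
qed

text \<open>Each factor of the series absorbs one denominator: the Bernoulli part takes
  \<open>fps_exp (of_nat v) - 1\<close>, and the geometric sum telescopes against
  \<open>fps_exp (of_nat w) - 1\<close>. What remains is visibly symmetric in \<open>v\<close> and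
  \<open>w\<close>.\<close>

lemma symmetric_series_mult_exp:
  assumes "v \<ge> 1"
  shows "symmetric_series v w x * ((fps_exp (of_nat v) - 1) * (fps_exp (of_nat w) - 1)) =
    fps_X * fps_exp (of_nat v * of_nat w * x :: 'a :: field_char_0) * (fps_exp (of_nat (v * w)) - 1)"
proof -
  let ?B = "Abs_fps (\<lambda>n. of_nat v ^ n * (poly (bernoulli_poly n) (of_nat w * x) / fact n)) :: 'a fps"
  let ?S = "\<Sum>j<v. fps_exp (of_nat (j * w)) :: 'a fps"
  have "(fps_exp (of_nat w) - 1) * ?S = (fps_exp (of_nat (v * w)) - 1 :: 'a fps)"
    using power_diff_1_eq[of "fps_exp (of_nat w) :: 'a fps" v]
    by (simp add: fps_exp_power_mult)
  moreover have "symmetric_series v w x * ((fps_exp (of_nat v) - 1) * (fps_exp (of_nat w) - 1)) =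
      fps_const (1 / of_nat v) * (?B * (fps_exp (of_nat v) - 1)) * ((fps_exp (of_nat w) - 1) * ?S)"
    by (simp only: symmetric_series_def mult_ac)
  moreover have "fps_const (1 / of_nat v) * (fps_const (of_nat v) * fps_X * f) = fps_X * f"
    for f :: "'a fps"
    using assms by (simp add: mult.assoc [symmetric])
  ultimately show ?thesis
    by (simp only: bernoulli_series_mult_exp) (simp only: mult.assoc)
qed

lemma symmetric_series_commute:
  assumes "v \<ge> 1" "w \<ge> 1"
  shows "symmetric_series v w x = symmetric_series w v (x :: 'a :: field_char_0)"
proof -
  let ?E = "(fps_exp (of_nat v) - 1) * (fps_exp (of_nat w) - 1) :: 'a fps"
  have "symmetric_series v w x * ?E = symmetric_series w v x * ?E"
    using symmetric_series_mult_exp[OF assms(1), of w x]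
      symmetric_series_mult_exp[OF assms(2), of v x]
    by (simp add: mult_ac)
  \<comment> \<open>Power series over a field form an integral domain, so the nonzero factor
    \<open>?E\<close> can be cancelled.\<close>
  moreover have "?E \<noteq> 0"
    using assms by (simp add: fps_exp_minus_1_nonzero)
  ultimately show ?thesis by simp
qed

lemma poly_bernoulli_power_sum:
  assumes "v \<ge> 1"
  shows "poly (\<Sum>i=0..n. smult (of_nat (n choose i) * of_nat (power_sum (n - i) (v - 1))
              * of_nat v powi (int i - 1) * of_nat w ^ (n - i))
            (pcompose (bernoulli_poly i) [:0, of_nat w:])) (x :: 'a :: field_char_0) =
         fact n * fps_nth (symmetric_series v w x) n"
proof -
  have S: "fps_nth (\<Sum>j<v. fps_exp (of_nat (j * w))) k =
      of_nat (power_sum k (v - 1)) * of_nat w ^ k / (fact k :: 'a)" for k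
  proof -
    \<comment> \<open>For \<open>v = 0\<close> the truncated \<open>v - 1\<close> would leave the
      index 0 in the right-hand set.\<close>
    have "{..<v} = {0..v - 1}" using assms by auto
    thus ?thesis
      by (simp add: fps_sum_nth power_sum_def power_mult_distrib sum_distrib_right
          sum_divide_distrib)
  qed
  have P: "of_nat v powi (int i - 1) = (of_nat v ^ i / of_nat v :: 'a)" for i
    using assms by (simp add: power_int_diff)
  have "fact n * fps_nth (symmetric_series v w x) n =
      (\<Sum>i=0..n. fact n * (1 / of_nat v *
        (of_nat v ^ i * (poly (bernoulli_poly i) (of_nat w * x) / fact i) *
         (of_nat (power_sum (n - i) (v - 1)) * of_nat w ^ (n - i) / fact (n - i)))))"
    \<comment> \<open>Reassociating exposes the Cauchy product of the Bernoulli series and the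
      exponential sum; its factorials combine with \<open>fact n\<close> into the binomial
      coefficient.\<close>
    unfolding symmetric_series_def mult.assoc fps_mult_left_const_nth
    unfolding fps_mult_nth S fps_nth_Abs_fps
    by (simp only: sum_distrib_left mult.assoc)
  also have "\<dots> = (\<Sum>i=0..n. of_nat (n choose i) * of_nat (power_sum (n - i) (v - 1))
              * of_nat v powi (int i - 1) * of_nat w ^ (n - i) *
              poly (bernoulli_poly i) (of_nat w * x))"
    by (rule sum.cong) (simp_all add: P binomial_fact mult_ac)
  finally show ?thesis
    by (simp add: poly_sum poly_pcompose mult_ac)
qed

theorem corollary2:
  fixes w1 w2 n :: nat
  assumes "w1 \<ge> 1" and "w2 \<ge> 1"
  shows "(\<Sum>i=0..n. smult (of_nat (n choose i) * of_nat (power_sum (n - i) (w1 - 1))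
              * of_nat w1 powi (int i - 1) * of_nat w2 ^ (n - i))
            (pcompose (bernoulli_poly i) [:0, of_nat w2:])) =
         (\<Sum>i=0..n. smult (of_nat (n choose i) * of_nat (power_sum (n - i) (w2 - 1))
              * of_nat w2 powi (int i - 1) * of_nat w1 ^ (n - i))
            (pcompose (bernoulli_poly i) [:0, of_nat w1:]) :: 'a :: field_char_0 poly)"
  \<comment> \<open>Over a field of characteristic 0 a polynomial is determined by its values, so it
    suffices to compare both sides at each point.\<close>
  unfolding poly_eq_poly_eq_iff [symmetric]
  by (rule ext)
     (simp only: poly_bernoulli_power_sum[OF assms(1)] poly_bernoulli_power_sum[OF assms(2)]
       symmetric_series_commute[OF assms])

end
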